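(* Let $G$ be a finite group, $\Omega$ a transitive right $G$-set and $H=G_\alpha$ the stabilizer of some $\alpha\in\Omega$. Let $S$ be an irreducible euclidean $G$-space with essential Wythoff dimension $m=1$ and let $w\in W=\operatorname{Fix}_S(H)$ have norm $1$. Then for every $g\in G$, $$\frac{|HgH\cup Hg^{-1}H|}{|H|}\,\langle wg,w\rangle$$ is an algebraic integer.
   Context: A euclidean $G$-space is a euclidean vector space $(V,\langle\cdot,\cdot\rangle)$ on which $G$ acts from the right by orthogonal transformations. For a simple (irreducible) euclidean $G$-space $S$, the Wythoff space is $W=\operatorname{Fix}_S(H)$, the space of $H$-fixed vectors, and the essential Wythoff dimension is the dimension of $W$ over the division ring $\mathbb{D}=\operatorname{End}_{\mathbb{R}G}(S)$. *)

theory Defs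
  imports "HOL-Analysis.Analysis" "HOL-Algebra.Coset"
begin

text \<open>Right actions \<open>act x g\<close>, read \<open>x g\<close>. (The locale \<open>group_action\<close> of HOL-Algebra
  describes left actions.)\<close>

locale right_action = group G for G :: "('g, 'm) monoid_scheme" (structure) +
  fixes X :: "'x set" and act :: "'x \<Rightarrow> 'g \<Rightarrow> 'x"
  assumes act_closed: "x \<in> X \<Longrightarrow> g \<in> carrier G \<Longrightarrow> act x g \<in> X"
    and act_one: "x \<in> X \<Longrightarrow> act x \<one> = x"
    and act_mult: "x \<in> X \<Longrightarrow> g \<in> carrier G \<Longrightarrow> h \<in> carrier G \<Longrightarrow>
      act x (g \<otimes> h) = act (act x g) h"

locale transitive_right_action = right_action +
  assumes nonempty: "X \<noteq> {}"
    and transitive: "x \<in> X \<Longrightarrow> y \<in> X \<Longrightarrow> \<exists>g\<in>carrier G. act x g = y"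

definition right_stabilizer ::
  "('g, 'm) monoid_scheme \<Rightarrow> ('x \<Rightarrow> 'g \<Rightarrow> 'x) \<Rightarrow> 'x \<Rightarrow> 'g set" where
  "right_stabilizer G act x = {g \<in> carrier G. act x g = x}"

text \<open>The underlying euclidean vector space is the whole type \<open>'s\<close>.\<close>

locale euclidean_G_space = right_action G UNIV act
  for G :: "('g, 'm) monoid_scheme" (structure)
    and act :: "'s::euclidean_space \<Rightarrow> 'g \<Rightarrow> 's" +
  assumes orthogonal: "g \<in> carrier G \<Longrightarrow> orthogonal_transformation (\<lambda>v. act v g)"

text \<open>A simple space is nonzero; this holds for every type of class \<open>euclidean_space\<close>.\<close>

locale irreducible_euclidean_G_space = euclidean_G_space +
  assumes irreducible: "subspace U \<Longrightarrow> (\<And>u g. u \<in> U \<Longrightarrow> g \<in> carrier G \<Longrightarrow> act u g \<in> U) \<Longrightarrow>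
      U = {0} \<or> U = UNIV"

definition wythoff_space :: "('s \<Rightarrow> 'g \<Rightarrow> 's) \<Rightarrow> 'g set \<Rightarrow> 's set" where
  "wythoff_space act H = {v. \<forall>h\<in>H. act v h = v}"

definition G_End ::
  "('g, 'm) monoid_scheme \<Rightarrow> ('s::real_vector \<Rightarrow> 'g \<Rightarrow> 's) \<Rightarrow> ('s \<Rightarrow> 's) set" where
  "G_End G act = {f. linear f \<and> (\<forall>g\<in>carrier G. \<forall>v. f (act v g) = act (f v) g)}"

text \<open>Linear algebra over a division ring \<open>D\<close> of endomorphisms, with scalar multiplication
  \<open>f \<cdot> v = f v\<close>. The locale \<open>module\<close> requires commutative scalars and does not apply, as \<open>D\<close>
  may be the quaternions. Since \<open>D\<close> contains the real scalars, all bases in a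
  finite-dimensional space are finite.\<close>

definition is_basis_over :: "('s \<Rightarrow> 's) set \<Rightarrow> 's set \<Rightarrow> 's::real_vector set \<Rightarrow> bool" where
  "is_basis_over D W B \<longleftrightarrow> finite B \<and> B \<subseteq> W \<and>
     (\<forall>c. (\<forall>b\<in>B. c b \<in> D) \<longrightarrow> (\<Sum>b\<in>B. c b b) = 0 \<longrightarrow> (\<forall>b\<in>B. c b = (\<lambda>v. 0))) \<and>
     (\<forall>w\<in>W. \<exists>c. (\<forall>b\<in>B. c b \<in> D) \<and> w = (\<Sum>b\<in>B. c b b))"

text \<open>Modelled on the library's \<open>dim\<close>; the value 0 in the absence of a basis is a dummy.\<close>

definition dim_over :: "('s \<Rightarrow> 's) set \<Rightarrow> 's::real_vector set \<Rightarrow> nat" where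
  "dim_over D W =
     (if \<exists>B. is_basis_over D W B then card (SOME B. is_basis_over D W B) else 0)"

definition essential_wythoff_dim ::
  "('g, 'm) monoid_scheme \<Rightarrow> ('s::real_vector \<Rightarrow> 'g \<Rightarrow> 's) \<Rightarrow> 'g set \<Rightarrow> nat" where
  "essential_wythoff_dim G act H = dim_over (G_End G act) (wythoff_space act H)"

end

theory Submission
  imports Defs "Jordan_Normal_Form.Char_Poly"
begin

text \<open>
  Let \<open>X\<close> be the union of the double cosets of \<open>g\<close> and of its inverse, and let \<open>T u\<close> be the sum
  of the vectors \<open>u x\<close> over \<open>x \<in> X\<close>. It suffices that \<open>T w = \<mu> w\<close> for a real \<open>\<mu>\<close> such that
  \<open>\<mu> / |H|\<close> is an algebraic integer: since \<open>\<langle>w x, w\<rangle>\<close> takes the same value for all \<open>x \<in> X\<close> and \<open>w\<close>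
  is a unit vector, \<open>\<mu> = \<langle>T w, w\<rangle> = |X| \<langle>w g, w\<rangle>\<close>.

  Why \<open>w\<close> is an eigenvector. The set \<open>X\<close> is stable under right multiplication by \<open>H\<close>, so \<open>T\<close> maps
  the Wythoff space \<open>W\<close> into itself, and \<open>T\<close> commutes with the division ring \<open>D\<close> of
  \<open>G\<close>-endomorphisms. If \<open>D\<close> is larger than the reals, a \<open>D\<close>-linear map of the one-dimensional \<open>D\<close>-space
  \<open>W\<close> need not be a real scalar. But \<open>X\<close> is closed under inversion, which makes \<open>T\<close> self-adjoint.
  Therefore \<open>T\<close> has an eigenvector in \<open>W\<close> with a real eigenvalue, and as this vector spans \<open>W\<close> over
  \<open>D\<close>, the map \<open>T\<close> is a real scalar on all of \<open>W\<close>
  (lemma \<open>self_adjoint_scalar_on_wythoff_space\<close>).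

  Why the eigenvalue is integral. For \<open>y \<in> G\<close>, applying \<open>y\<close> to \<open>\<mu> w = T w\<close> writes \<open>\<mu> (w y)\<close> as the
  sum of the vectors \<open>w x y\<close>. The \<open>x \<in> X\<close> for which \<open>w x y\<close> is a given vector form a union of right
  cosets of \<open>H\<close>, so their number is divisible by \<open>|H|\<close>. Hence multiplication by \<open>\<mu> / |H|\<close> acts on the
  family of the vectors in the orbit of \<open>w\<close> by an integer matrix, and \<open>\<mu> / |H|\<close> is a root of a monic
  integer polynomial, the characteristic polynomial of this matrix
  (lemma \<open>orbit_sum_eigenvalue_integral\<close>).
\<close>

section \<open>Integrality of eigenvalues\<close>

text \<open>The criterion that a number is integral if multiplication by it preserves a nonzero finitely
  generated group. Pairing the relations with \<open>u\<close> turns them into one eigenvector equation for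
  an integer matrix; the eigenvector is nonzero because its entry at \<open>u\<close> is \<open>\<langle>u, u\<rangle>\<close>.\<close>

lemma algebraic_int_if_integral_eigen_relation:
  fixes E :: "'s::real_inner set" and u :: 's and \<mu> :: real
  assumes fin: "finite E" and u: "u \<in> E" "u \<noteq> 0"
    and rel: "\<And>v. v \<in> E \<Longrightarrow> \<exists>a :: 's \<Rightarrow> int. \<mu> *\<^sub>R v = (\<Sum>e\<in>E. of_int (a e) *\<^sub>R e)"
  shows "algebraic_int \<mu>"
proof -
  obtain a :: "'s \<Rightarrow> 's \<Rightarrow> int"
    where a: "\<And>v. v \<in> E \<Longrightarrow> \<mu> *\<^sub>R v = (\<Sum>e\<in>E. of_int (a v e) *\<^sub>R e)"
    using rel by metis
  define n where "n = card E"
  obtain e where e: "bij_betw e {0..<n} E"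
    using ex_bij_betw_nat_finite[OF fin] n_def by blast
  define A :: "int mat" where "A = mat n n (\<lambda>(i, j). a (e i) (e j))"
  define B :: "real mat" where "B = map_mat of_int A"
  define x :: "real vec" where "x = vec n (\<lambda>i. inner (e i) u)"
  have A: "A \<in> carrier_mat n n" and B: "B \<in> carrier_mat n n"
    by (auto simp: A_def B_def)
  have eE: "e i \<in> E" if "i < n" for i
    using e that by (auto simp: bij_betw_def)
  have "B *\<^sub>v x = \<mu> \<cdot>\<^sub>v x"
  proof (rule eq_vecI)
    fix i assume "i < dim_vec (\<mu> \<cdot>\<^sub>v x)"
    then have i: "i < n" by (simp add: x_def)
    have "(B *\<^sub>v x) $ i = (\<Sum>j\<in>{0..<n}. of_int (a (e i) (e j)) * inner (e j) u)"
      using i by (simp add: B_def A_def x_def scalar_prod_def)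
    also have "\<dots> = (\<Sum>v\<in>E. of_int (a (e i) v) * inner v u)"
      by (rule sum.reindex_bij_betw[OF e])
    also have "\<dots> = inner (\<Sum>v\<in>E. of_int (a (e i) v) *\<^sub>R v) u"
      by (simp add: inner_sum_left)
    also have "\<dots> = \<mu> * inner (e i) u"
      by (simp add: a[OF eE[OF i], symmetric])
    finally show "(B *\<^sub>v x) $ i = (\<mu> \<cdot>\<^sub>v x) $ i"
      using i by (simp add: x_def)
  qed (use B in \<open>simp add: x_def\<close>)
  moreover have "x \<noteq> 0\<^sub>v n"
  proof -
    obtain k where k: "k < n" "e k = u"
      using e u(1) by (force simp: bij_betw_def)
    then have "x $ k \<noteq> 0" using u(2) by (simp add: x_def)
    then show ?thesis using k(1) by auto
  qed
  moreover have "x \<in> carrier_vec n" by (simp add: x_def)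
  ultimately have "eigenvalue B \<mu>"
    using B by (auto simp: eigenvalue_def eigenvector_def)
  then have "poly (char_poly B) \<mu> = 0"
    by (simp add: eigenvalue_root_char_poly[OF B])
  moreover have "char_poly B = of_int_poly (char_poly A)"
    unfolding B_def by (rule of_int_hom.char_poly_hom[OF A])
  moreover have "monic (char_poly A)"
    using degree_monic_char_poly[OF A] by simp
  ultimately show ?thesis
    unfolding algebraic_int_altdef_ipoly by metis
qed

section \<open>Eigenvectors of self-adjoint maps\<close>

text \<open>A maximum of the Rayleigh quotient \<open>\<langle>T u, u\<rangle> / \<langle>u, u\<rangle>\<close> on \<open>W\<close>, which exists by compactness of
  the unit sphere, is an eigenvector. Indeed, with \<open>\<mu>\<close> the maximal value, the quadratic form
  \<open>B u = \<mu> \<langle>u, u\<rangle> - \<langle>T u, u\<rangle>\<close> is nonnegative on \<open>W\<close> and vanishes at \<open>v\<close>. Its derivative at \<open>v\<close> in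
  the direction of the residue \<open>r = \<mu> v - T v\<close> is \<open>2 \<langle>r, r\<rangle>\<close>, so \<open>r\<close> has to be zero.\<close>

lemma self_adjoint_has_eigenvector:
  fixes T :: "'s::euclidean_space \<Rightarrow> 's"
  assumes "linear T" and W: "subspace W" "W \<noteq> {0}"
    and inv: "\<And>u. u \<in> W \<Longrightarrow> T u \<in> W"
    and sym: "\<And>u v. u \<in> W \<Longrightarrow> v \<in> W \<Longrightarrow> inner (T u) v = inner u (T v)"
  obtains v \<mu> where "v \<in> W" "v \<noteq> 0" "T v = \<mu> *\<^sub>R v"
proof -
  interpret T: linear T by fact
  let ?K = "W \<inter> sphere 0 1"
  have "compact ?K"
    using closed_subspace[OF W(1)] by (simp add: closed_Int_compact)
  moreover have "?K \<noteq> {}"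
  proof -
    obtain u where u: "u \<in> W" "u \<noteq> 0"
      using W subspace_0 by blast
    then have "(1 / norm u) *\<^sub>R u \<in> ?K"
      using W(1) by (simp add: subspace_scale)
    then show ?thesis by blast
  qed
  moreover have "continuous_on ?K (\<lambda>u. inner (T u) u)"
    using \<open>linear T\<close>
    by (simp add: continuous_on_inner linear_continuous_on linear_conv_bounded_linear)
  ultimately obtain v where v: "v \<in> ?K" and max: "\<And>u. u \<in> ?K \<Longrightarrow> inner (T u) u \<le> inner (T v) v"
    using continuous_attains_sup[of ?K "\<lambda>u. inner (T u) u"] by blast
  have vW: "v \<in> W" and nv: "norm v = 1" using v by auto
  define \<mu> where "\<mu> = inner (T v) v"
  define r where "r = \<mu> *\<^sub>R v - T v"
  define B where "B = (\<lambda>u. \<mu> * inner u u - inner (T u) u)"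
  have rW: "r \<in> W"
    unfolding r_def using vW inv W(1) by (intro subspace_diff subspace_scale) auto
  have B_nonneg: "0 \<le> B u" if "u \<in> W" for u
  proof (cases "u = 0")
    case False
    then have "(1 / norm u) *\<^sub>R u \<in> ?K"
      using W(1) that by (simp add: subspace_scale)
    from max[OF this] have "inner (T u) u / (norm u)\<^sup>2 \<le> \<mu>"
      by (simp add: T.scale \<mu>_def power2_eq_square)
    then show ?thesis
      using False by (simp add: B_def field_simps power2_norm_eq_inner)
  qed (simp add: B_def)
  have expand: "B (v + t *\<^sub>R r) = 2 * t * inner r r + t\<^sup>2 * B r" for t
  proof -
    have "inner (T r) v = inner (T v) r"
      using sym[OF rW vW] by (simp add: inner_commute)
    moreover have "inner v v = 1" using nv by (simp add: dot_square_norm)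
    ultimately have "B (v + t *\<^sub>R r) = 2 * t * (\<mu> * inner v r - inner (T v) r) + t\<^sup>2 * B r"
      by (simp add: B_def T.add T.scale inner_add_left inner_add_right \<mu>_def[symmetric]
          inner_commute[of r v] algebra_simps power2_eq_square)
    also have "\<mu> * inner v r - inner (T v) r = inner r r"
      unfolding r_def by (simp only: inner_diff_left inner_scaleR_left)
    finally show ?thesis .
  qed
  have "inner r r = 0"
  proof (rule ccontr)
    assume "inner r r \<noteq> 0"
    then have pos: "inner r r > 0" by simp
    \<comment> \<open>The exact minimiser would be \<open>- inner r r / B r\<close>; adding 1 covers the case \<open>B r = 0\<close> and
      still leaves a negative value.\<close>
    define t where "t = - inner r r / (B r + 1)"
    have "B r + 1 > 0" using B_nonneg[OF rW] by simp
    have "2 * t * inner r r + t\<^sup>2 * B r = t * (2 * inner r r + t * B r)"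
      by (simp add: algebra_simps power2_eq_square)
    moreover have "t < 0" using pos \<open>B r + 1 > 0\<close> by (simp add: t_def divide_neg_pos)
    moreover have "2 * inner r r + t * B r > 0"
    proof -
      have "- t * B r \<le> inner r r"
        using pos \<open>B r + 1 > 0\<close> by (simp add: t_def field_simps)
      then show ?thesis using pos by linarith
    qed
    ultimately have "2 * t * inner r r + t\<^sup>2 * B r < 0"
      by (simp add: mult_neg_pos)
    moreover have "0 \<le> B (v + t *\<^sub>R r)"
      using rW vW W(1) by (intro B_nonneg subspace_add subspace_scale)
    ultimately show False by (simp add: expand)
  qed
  then have "T v = \<mu> *\<^sub>R v" by (simp add: r_def)
  moreover have "v \<noteq> 0" using nv by auto
  ultimately show thesis using that vW by blast
qed

section \<open>Stabilizers and cosets\<close>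

lemma (in right_action) subgroup_right_stabilizer:
  assumes "x \<in> X"
  shows "subgroup (right_stabilizer G act x) G"
proof
  fix g assume "g \<in> right_stabilizer G act x"
  then have g: "g \<in> carrier G" "act x g = x" by (auto simp: right_stabilizer_def)
  then have "act x (inv g) = act (act x g) (inv g)" by simp
  also have "\<dots> = act x (g \<otimes> inv g)" using assms g(1) by (intro act_mult[symmetric]) auto
  also have "\<dots> = x" using assms g(1) by (simp add: act_one)
  finally show "inv g \<in> right_stabilizer G act x"
    using g assms by (simp add: right_stabilizer_def act_one)
qed (use assms in \<open>auto simp: right_stabilizer_def act_one act_mult\<close>)

text \<open>Such a set \<open>S\<close> is a disjoint union of right cosets of \<open>H\<close>.\<close>

lemma (in group) card_subgroup_dvd_card_left_stable:
  assumes "subgroup H G" and "S \<subseteq> carrier G" "finite S"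
    and stable: "\<And>h x. h \<in> H \<Longrightarrow> x \<in> S \<Longrightarrow> h \<otimes> x \<in> S"
  shows "card H dvd card S"
proof -
  have HG: "H \<subseteq> carrier G" using assms(1) by (rule subgroup.subset)
  let ?C = "(\<lambda>x. H #> x) ` S"
  have C: "?C \<subseteq> rcosets H"
    using assms(2) HG by (auto intro: rcosetsI)
  have S: "\<Union>?C = S"
  proof
    show "\<Union>?C \<subseteq> S" using stable by (auto simp: r_coset_def)
    show "S \<subseteq> \<Union>?C" using assms(2) rcos_self[OF _ assms(1)] by blast
  qed
  have "card H dvd card (\<Union>?C)"
  proof (rule dvd_partition)
    show "finite (\<Union>?C)" using S assms(3) by simp
    show "\<forall>c\<in>?C. card H dvd card c"
      using C card_rcosets_equal[OF _ HG] by fastforce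
    show "\<forall>c1\<in>?C. \<forall>c2\<in>?C. c1 \<noteq> c2 \<longrightarrow> c1 \<inter> c2 = {}"
      using C rcos_disjoint[OF assms(1)] unfolding pairwise_def disjnt_def by blast
  qed
  then show ?thesis by (simp only: S)
qed

lemma (in group) mem_double_coset_iff:
  "x \<in> (H #> g) <#> K \<longleftrightarrow> (\<exists>h\<in>H. \<exists>k\<in>K. x = h \<otimes> g \<otimes> k)"
  by (auto simp: r_coset_def set_mult_def)

section \<open>Endomorphisms and the Wythoff space\<close>

context irreducible_euclidean_G_space
begin

lemma linear_act: "g \<in> carrier G \<Longrightarrow> linear (\<lambda>v. act v g)"
  using orthogonal by (simp add: orthogonal_transformation_def)

lemma inner_act: "g \<in> carrier G \<Longrightarrow> inner (act u g) (act v g) = inner u v"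
  using orthogonal by (simp add: orthogonal_transformation_def)

lemma inner_act_inv:
  assumes "g \<in> carrier G"
  shows "inner (act u g) v = inner u (act v (inv g))"
proof -
  have "act (act v (inv g)) g = v"
    using assms act_mult[of v "inv g" g] by (simp add: act_one)
  then show ?thesis using inner_act[OF assms, of u "act v (inv g)"] by simp
qed

lemma subspace_wythoff_space:
  assumes "H \<subseteq> carrier G"
  shows "subspace (wythoff_space act H)"
proof -
  have "subspace {v. act v h = v}" if "h \<in> carrier G" for h
    using linear_0[OF linear_act[OF that]] linear_add[OF linear_act[OF that]]
      linear_scale[OF linear_act[OF that]] by (simp add: subspace_def)
  then show ?thesis
    using assms unfolding wythoff_space_def subspace_def by (simp add: subset_iff)
qed

text \<open>Schur's lemma: the kernel of \<open>c\<close> is an invariant subspace.\<close>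

lemma G_End_eq_0_iff:
  assumes "c \<in> G_End G act" "c \<noteq> (\<lambda>v. 0)"
  shows "c v = 0 \<longleftrightarrow> v = 0"
proof -
  interpret c: linear c using assms(1) by (simp add: G_End_def)
  have "{v. c v = 0} = {0} \<or> {v. c v = 0} = UNIV"
  proof (rule irreducible)
    show "subspace {v. c v = 0}" by (simp add: subspace_def c.add c.scale c.zero)
    fix u g assume u: "u \<in> {v. c v = 0}" and g: "g \<in> carrier G"
    then have "c (act u g) = act 0 g" using assms(1) by (simp add: G_End_def)
    also have "\<dots> = 0" by (rule linear_0[OF linear_act[OF g]])
    finally show "act u g \<in> {v. c v = 0}" by simp
  qed
  then show ?thesis using assms(2) c.zero by blast
qed

text \<open>A basis vector \<open>b\<close> gives \<open>W = D b\<close>. An eigenvector \<open>v \<in> W\<close> of \<open>T\<close> has the form \<open>c b\<close>, and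
  \<open>c (T b - \<mu> b) = T v - \<mu> v = 0\<close>; since \<open>c\<close> is injective, \<open>b\<close> is an eigenvector too.
  Finally \<open>T (d b) = d (T b) = d (\<mu> b) = \<mu> (d b)\<close>, because \<open>d\<close> commutes with real scalars.\<close>

lemma self_adjoint_scalar_on_wythoff_space:
  assumes H: "H \<subseteq> carrier G" and dim: "essential_wythoff_dim G act H = 1"
    and T: "linear T" "\<And>u. u \<in> wythoff_space act H \<Longrightarrow> T u \<in> wythoff_space act H"
    and sym: "\<And>u v. inner (T u) v = inner u (T v)"
    and comm: "\<And>c u. c \<in> G_End G act \<Longrightarrow> T (c u) = c (T u)"
  obtains \<mu> where "\<And>u. u \<in> wythoff_space act H \<Longrightarrow> T u = \<mu> *\<^sub>R u"
proof -
  let ?W = "wythoff_space act H" and ?D = "G_End G act"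
  let ?B = "SOME B. is_basis_over ?D ?W B"
  have ex: "\<exists>B. is_basis_over ?D ?W B" and card: "card ?B = 1"
    using dim by (auto simp: essential_wythoff_dim_def dim_over_def split: if_splits)
  obtain b where b: "?B = {b}" using card by (rule card_1_singletonE)
  have basis: "is_basis_over ?D ?W {b}" using someI_ex[OF ex] by (simp only: b)
  have span: "\<exists>c\<in>?D. u = c b" if "u \<in> ?W" for u
  proof -
    have "\<exists>c. (\<forall>b'\<in>{b}. c b' \<in> ?D) \<and> u = (\<Sum>b'\<in>{b}. c b' b')"
      using basis that unfolding is_basis_over_def by (elim conjE bspec)
    then show ?thesis by auto
  qed
  have "b \<noteq> 0"
  proof
    assume "b = 0"
    \<comment> \<open>A zero basis vector would be killed by the identity, contrary to independence.\<close>
    have "id \<in> ?D" by (simp add: G_End_def linear_id)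
    moreover have "\<forall>c. (\<forall>b'\<in>{b}. c b' \<in> ?D) \<longrightarrow> (\<Sum>b'\<in>{b}. c b' b') = 0
        \<longrightarrow> (\<forall>b'\<in>{b}. c b' = (\<lambda>v. 0))"
      using basis unfolding is_basis_over_def by (elim conjE)
    from spec[OF this, of "\<lambda>_. id"]
    have "id \<in> ?D \<longrightarrow> id b = 0 \<longrightarrow> id = (\<lambda>v. 0 :: 'c)" by simp
    ultimately have "id = (\<lambda>v. 0 :: 'c)" using \<open>b = 0\<close> by simp
    then show False
      using vector_choose_size[of 1] by (metis id_apply norm_zero zero_le_one zero_neq_one)
  qed
  moreover have "b \<in> ?W" using basis by (simp add: is_basis_over_def)
  ultimately have "?W \<noteq> {0}" by blast
  then obtain v \<mu> where v: "v \<in> ?W" "v \<noteq> 0" "T v = \<mu> *\<^sub>R v"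
    using self_adjoint_has_eigenvector[OF T(1) subspace_wythoff_space[OF H]] T(2) sym by metis
  obtain c where c: "c \<in> ?D" "v = c b" using span v(1) by blast
  interpret c: linear c using c(1) by (simp add: G_End_def)
  have "c (T b - \<mu> *\<^sub>R b) = 0"
    using v(3) comm[OF c(1)] by (simp add: c.diff c.scale c(2))
  moreover have "c \<noteq> (\<lambda>v. 0)" using v(2) c(2) by auto
  ultimately have Tb: "T b = \<mu> *\<^sub>R b"
    using G_End_eq_0_iff[OF c(1)] by simp
  have "T u = \<mu> *\<^sub>R u" if "u \<in> ?W" for u
  proof -
    obtain d where d: "d \<in> ?D" "u = d b" using span \<open>u \<in> ?W\<close> by blast
    then have "linear d" by (simp add: G_End_def)
    then show ?thesis using comm[OF d(1)] d(2) Tb by (simp add: linear_scale)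
  qed
  then show thesis by (rule that)
qed

section \<open>Orbit sums\<close>

text \<open>The action on \<open>u\<close> of the element of the group ring that is the sum of \<open>X\<close>; for \<open>u\<close> fixed by
  \<open>H\<close> and \<open>X\<close> a union of double cosets of \<open>H\<close>, this is a Hecke operator multiplied by \<open>|H|\<close>.\<close>

definition orbit_sum where
  "orbit_sum X u = (\<Sum>x\<in>X. act u x)"

lemma linear_orbit_sum:
  assumes "X \<subseteq> carrier G"
  shows "linear (orbit_sum X)"
  unfolding orbit_sum_def [abs_def]
  using assms by (intro linear_compose_sum ballI linear_act) auto

text \<open>The adjoint of an orthogonal transformation is its inverse, so taking the adjoint replaces
  \<open>X\<close> by the set of inverses of its elements.\<close>

lemma orbit_sum_self_adjoint:
  assumes "X \<subseteq> carrier G" and "\<And>x. x \<in> X \<Longrightarrow> inv x \<in> X"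
  shows "inner (orbit_sum X u) v = inner u (orbit_sum X v)"
proof -
  have "(\<Sum>x\<in>X. inner (act u x) v) = (\<Sum>x\<in>X. inner u (act v (inv x)))"
    using assms(1) by (intro sum.cong) (auto simp: inner_act_inv)
  also have "\<dots> = (\<Sum>x\<in>X. inner u (act v x))"
    by (rule sum.reindex_bij_witness[of _ "\<lambda>x. inv x" "\<lambda>x. inv x"]) (use assms in auto)
  finally show ?thesis by (simp add: orbit_sum_def inner_sum_left inner_sum_right)
qed

lemma orbit_sum_commutes_G_End:
  assumes "X \<subseteq> carrier G" "c \<in> G_End G act"
  shows "orbit_sum X (c u) = c (orbit_sum X u)"
proof -
  have "linear c" using assms(2) by (simp add: G_End_def)
  then show ?thesis
    using assms by (auto simp: orbit_sum_def linear_sum G_End_def intro!: sum.cong)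
qed

text \<open>Right multiplication by \<open>h \<in> H\<close> permutes \<open>X\<close>.\<close>

lemma orbit_sum_in_wythoff_space:
  assumes X: "X \<subseteq> carrier G" and H: "subgroup H G"
    and XH: "\<And>x h. x \<in> X \<Longrightarrow> h \<in> H \<Longrightarrow> x \<otimes> h \<in> X"
  shows "orbit_sum X u \<in> wythoff_space act H"
proof -
  interpret H: subgroup H G by fact
  have "act (orbit_sum X u) h = orbit_sum X u" if h: "h \<in> H" for h
  proof -
    have hG: "h \<in> carrier G" using h by simp
    have "act (orbit_sum X u) h = (\<Sum>x\<in>X. act u (x \<otimes> h))"
      using X hG by (auto simp: orbit_sum_def linear_sum[OF linear_act[OF hG]] act_mult
          intro!: sum.cong)
    also have "\<dots> = orbit_sum X u"
      unfolding orbit_sum_def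
      by (rule sum.reindex_bij_witness[of _ "\<lambda>x. x \<otimes> inv h" "\<lambda>x. x \<otimes> h"])
        (use X XH h hG in \<open>auto simp: m_assoc subset_iff\<close>)
    finally show ?thesis .
  qed
  then show ?thesis by (simp add: wythoff_space_def)
qed

text \<open>Apply \<open>y \<in> G\<close> to the eigenvalue equation: \<open>\<mu> (w y)\<close> is the sum of the vectors \<open>w x y\<close> over
  \<open>x \<in> X\<close>. Each vector \<open>e\<close> of the orbit of \<open>w\<close> occurs in this sum a number of times divisible by
  \<open>|H|\<close>, because \<open>w h x y = w x y\<close> for \<open>h \<in> H\<close>. Division by \<open>|H|\<close> thus leaves integer
  coefficients. Working with the orbit as a set of vectors lets the argument go through also
  when the stabilizer of \<open>w\<close> is larger than \<open>H\<close>.\<close>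

lemma orbit_sum_eigenvalue_integral:
  assumes fin: "finite (carrier G)" and H: "subgroup H G"
    and X: "X \<subseteq> carrier G" and HX: "\<And>h x. h \<in> H \<Longrightarrow> x \<in> X \<Longrightarrow> h \<otimes> x \<in> X"
    and w: "w \<in> wythoff_space act H" "w \<noteq> 0" and eig: "orbit_sum X w = \<mu> *\<^sub>R w"
  shows "algebraic_int (\<mu> / card H)"
proof (rule algebraic_int_if_integral_eigen_relation)
  let ?E = "(\<lambda>y. act w y) ` carrier G"
  interpret H: subgroup H G by fact
  have finX: "finite X" using X fin by (rule finite_subset)
  have "finite H" using fin H.subset by (rule rev_finite_subset)
  then have H0: "card H > 0" using H.one_closed card_gt_0_iff by blast
  show "finite ?E" using fin by simp
  show "w \<in> ?E" using act_one[of w] by (metis UNIV_I imageI one_closed)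
  show "w \<noteq> 0" by fact
  fix v assume "v \<in> ?E"
  then obtain y where y: "y \<in> carrier G" "v = act w y" by blast
  define F where "F = (\<lambda>e. {x \<in> X. act w (x \<otimes> y) = e})"
  have dvd: "card H dvd card (F e)" for e
  proof (rule card_subgroup_dvd_card_left_stable[OF H])
    fix h x assume hx: "h \<in> H" "x \<in> F e"
    then have G: "h \<in> carrier G" "x \<in> carrier G" using X by (auto simp: F_def)
    have "act w (h \<otimes> x \<otimes> y) = act (act w h) (x \<otimes> y)"
      using G y(1) by (simp add: m_assoc act_mult)
    also have "act w h = w" using w(1) hx(1) by (simp add: wythoff_space_def)
    finally show "h \<otimes> x \<in> F e" using hx HX by (simp add: F_def)
  qed (use X finX in \<open>auto simp: F_def\<close>)
  have "\<mu> *\<^sub>R v = act (orbit_sum X w) y"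
    by (simp add: eig y linear_scale[OF linear_act[OF y(1)]])
  also have "\<dots> = (\<Sum>x\<in>X. act w (x \<otimes> y))"
    using X y(1) by (auto simp: orbit_sum_def linear_sum[OF linear_act[OF y(1)]] act_mult
        intro!: sum.cong)
  also have "\<dots> = (\<Sum>e\<in>?E. \<Sum>x\<in>F e. act w (x \<otimes> y))"
    unfolding F_def
    by (rule sum.group[symmetric]) (use X y(1) fin finX in auto)
  also have "\<dots> = (\<Sum>e\<in>?E. real (card (F e)) *\<^sub>R e)"
    by (intro sum.cong refl) (simp add: F_def sum_constant_scaleR)
  finally have "\<mu> *\<^sub>R v = (\<Sum>e\<in>?E. real (card (F e)) *\<^sub>R e)" .
  then have "(1 / card H) *\<^sub>R \<mu> *\<^sub>R v = (\<Sum>e\<in>?E. (1 / card H) *\<^sub>R real (card (F e)) *\<^sub>R e)"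
    by (simp only: scaleR_sum_right)
  then have "(\<mu> / card H) *\<^sub>R v = (\<Sum>e\<in>?E. (real (card (F e)) / card H) *\<^sub>R e)"
    by simp
  also have "\<dots> = (\<Sum>e\<in>?E. of_int (int (card (F e) div card H)) *\<^sub>R e)"
    using dvd H0 by (simp add: real_of_nat_div)
  finally show "\<exists>a. (\<mu> / card H) *\<^sub>R v = (\<Sum>e\<in>?E. of_int (a e) *\<^sub>R e)"
    by (rule exI[of _ "\<lambda>e. int (card (F e) div card H)"])
qed

lemma inner_orbit_constant_on_double_coset:
  assumes H: "subgroup H G" and w: "w \<in> wythoff_space act H"
    and "g \<in> carrier G" "h \<in> H" "k \<in> H"
  shows "inner (act w (h \<otimes> g \<otimes> k)) w = inner (act w g) w"
proof -
  interpret H: subgroup H G by fact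
  have w_fixed: "act w x = w" if "x \<in> H" for x using w that by (simp add: wythoff_space_def)
  have "act w (h \<otimes> g \<otimes> k) = act (act w g) k"
    using assms by (simp add: act_mult w_fixed)
  then show ?thesis using assms by (simp add: inner_act_inv w_fixed)
qed

end

theorem corollary6p3:
  fixes G :: "('g, 'm) monoid_scheme"
    and \<Omega> :: "'x set" and act\<^sub>\<Omega> :: "'x \<Rightarrow> 'g \<Rightarrow> 'x" and \<alpha> :: 'x and H :: "'g set"
    and act :: "'s::euclidean_space \<Rightarrow> 'g \<Rightarrow> 's" and w :: 's
  assumes "group G" and "finite (carrier G)"
    and "transitive_right_action G \<Omega> act\<^sub>\<Omega>" and "\<alpha> \<in> \<Omega>"
    and "H = right_stabilizer G act\<^sub>\<Omega> \<alpha>"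
    and "irreducible_euclidean_G_space G act"
    and "essential_wythoff_dim G act H = 1"
    and "w \<in> wythoff_space act H" and "norm w = 1"
  shows "\<forall>g\<in>carrier G. algebraic_int
    (real (card (((H #>\<^bsub>G\<^esub> g) <#>\<^bsub>G\<^esub> H) \<union> ((H #>\<^bsub>G\<^esub> (inv\<^bsub>G\<^esub> g)) <#>\<^bsub>G\<^esub> H))) / real (card H)
      * (act w g \<bullet> w))"
proof
  fix g assume g: "g \<in> carrier G"
  interpret S: irreducible_euclidean_G_space G act by fact
  interpret \<Omega>: transitive_right_action G \<Omega> act\<^sub>\<Omega> by fact
  have sub: "subgroup H G"
    using \<Omega>.subgroup_right_stabilizer[OF \<open>\<alpha> \<in> \<Omega>\<close>] assms(5) by simp
  interpret H: subgroup H G by (rule sub)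
  define X where "X = ((H #>\<^bsub>G\<^esub> g) <#>\<^bsub>G\<^esub> H) \<union> ((H #>\<^bsub>G\<^esub> (inv\<^bsub>G\<^esub> g)) <#>\<^bsub>G\<^esub> H)"
  have memX: "x \<in> X \<longleftrightarrow> (\<exists>f\<in>{g, inv\<^bsub>G\<^esub> g}. \<exists>h\<in>H. \<exists>k\<in>H. x = h \<otimes>\<^bsub>G\<^esub> f \<otimes>\<^bsub>G\<^esub> k)" for x
    by (simp add: X_def S.mem_double_coset_iff)
  have X: "X \<subseteq> carrier G"
    using g by (auto simp: memX)
  have inv_X: "inv\<^bsub>G\<^esub> x \<in> X" if x: "x \<in> X" for x
  proof -
    obtain f h k where f: "f \<in> {g, inv\<^bsub>G\<^esub> g}" "h \<in> H" "k \<in> H" "x = h \<otimes>\<^bsub>G\<^esub> f \<otimes>\<^bsub>G\<^esub> k"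
      using x unfolding memX by blast
    then have "inv\<^bsub>G\<^esub> x = inv\<^bsub>G\<^esub> k \<otimes>\<^bsub>G\<^esub> inv\<^bsub>G\<^esub> f \<otimes>\<^bsub>G\<^esub> inv\<^bsub>G\<^esub> h"
      using g by (auto simp: S.inv_mult_group S.m_assoc)
    moreover have "inv\<^bsub>G\<^esub> f \<in> {g, inv\<^bsub>G\<^esub> g}" using f(1) g by auto
    ultimately show ?thesis
      using H.m_inv_closed[OF f(2)] H.m_inv_closed[OF f(3)] unfolding memX by metis
  qed
  have HX: "y \<otimes>\<^bsub>G\<^esub> x \<in> X" if yx: "y \<in> H" "x \<in> X" for y x
  proof -
    obtain f h k where f: "f \<in> {g, inv\<^bsub>G\<^esub> g}" "h \<in> H" "k \<in> H" "x = h \<otimes>\<^bsub>G\<^esub> f \<otimes>\<^bsub>G\<^esub> k"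
      using yx unfolding memX by blast
    then have "y \<otimes>\<^bsub>G\<^esub> x = (y \<otimes>\<^bsub>G\<^esub> h) \<otimes>\<^bsub>G\<^esub> f \<otimes>\<^bsub>G\<^esub> k"
      using g yx by (auto simp: S.m_assoc)
    then show ?thesis using f(1,3) H.m_closed[OF yx(1) f(2)] unfolding memX by metis
  qed
  \<comment> \<open>\<open>x y\<close> is the inverse of \<open>y\<^sup>-\<^sup>1 x\<^sup>-\<^sup>1\<close>, so the right stability follows from the left one.\<close>
  have XH: "x \<otimes>\<^bsub>G\<^esub> y \<in> X" if yx: "x \<in> X" "y \<in> H" for y x
    using inv_X[OF HX[OF H.m_inv_closed[OF yx(2)] inv_X[OF yx(1)]]] X yx
    by (auto simp: S.inv_mult_group subset_iff)
  obtain \<mu> where \<mu>: "\<And>u. u \<in> wythoff_space act H \<Longrightarrow> S.orbit_sum X u = \<mu> *\<^sub>R u"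
    using S.self_adjoint_scalar_on_wythoff_space[OF H.subset assms(7) S.linear_orbit_sum[OF X]
        S.orbit_sum_in_wythoff_space[OF X sub XH] S.orbit_sum_self_adjoint[OF X inv_X]
        S.orbit_sum_commutes_G_End[OF X]] by metis
  have const: "inner (act w x) w = inner (act w g) w" if x: "x \<in> X" for x
  proof -
    obtain f h k where f: "f \<in> {g, inv\<^bsub>G\<^esub> g}" "h \<in> H" "k \<in> H" "x = h \<otimes>\<^bsub>G\<^esub> f \<otimes>\<^bsub>G\<^esub> k"
      using x unfolding memX by blast
    then have "inner (act w x) w = inner (act w f) w"
      using S.inner_orbit_constant_on_double_coset[OF sub assms(8)] g by auto
    also have "\<dots> = inner (act w g) w"
      using f(1) S.inner_act_inv[OF g, of w w] by (auto simp: inner_commute)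
    finally show ?thesis .
  qed
  have "\<mu> = inner (S.orbit_sum X w) w"
    using \<mu>[OF assms(8)] assms(9) by (simp add: dot_square_norm)
  also have "\<dots> = real (card X) * inner (act w g) w"
    by (simp add: S.orbit_sum_def inner_sum_left const)
  finally have "\<mu> / card H = real (card X) / real (card H) * inner (act w g) w"
    by simp
  moreover have "algebraic_int (\<mu> / card H)"
    using S.orbit_sum_eigenvalue_integral[OF assms(2) sub X HX assms(8) _ \<mu>[OF assms(8)]]
      assms(9) by fastforce
  ultimately show "algebraic_int
    (real (card (((H #>\<^bsub>G\<^esub> g) <#>\<^bsub>G\<^esub> H) \<union> ((H #>\<^bsub>G\<^esub> (inv\<^bsub>G\<^esub> g)) <#>\<^bsub>G\<^esub> H))) / real (card H)
      * (act w g \<bullet> w))"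
    by (simp only: X_def)
qed

end
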